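(* Let $a,b\geq 2$ be integers, and let $G = aK_2\,\nabla\, K_b$ and $G' = aK_2\,\nabla\, bK_1$, both graphs of order $n=2a+b$. Then $G$ and $G'$ are $\mathcal{L}$-noncospectral and have the same normalized Laplacian energy. Furthermore, $$E_{\mathcal{L}}(G)=E_{\mathcal{L}}(G')=\frac{2a+2b}{b+1}.$$
   Context: All graphs are finite, undirected, without loops or multiple edges. $K_m$ is the complete graph on $m$ vertices; $mH$ denotes the disjoint union of $m$ copies of a graph $H$; the join $G_1\nabla G_2$ is the graph obtained from the disjoint union of $G_1$ and $G_2$ by joining every vertex of $G_1$ to every vertex of $G_2$. For a graph without isolated vertices, the normalized Laplacian matrix is $\mathcal{L}=D^{-1/2}(D-A)D^{-1/2}$, where $A$ is the adjacency matrix and $D$ the diagonal degree matrix. If $\lambda_1,\dots,\lambda_n$ are the eigenvalues of $\mathcal{L}$ (with multiplicity) for a graph $G$ of order $n$, the normalized Laplacian energy is $E_{\mathcal{L}}(G)=\sum_{i=1}^n|\lambda_i-1|$. Two graphs are $\mathcal{L}$-noncospectral if their normalized Laplacian spectra (as multisets) are different. *)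

theory Defs
  imports
    "Graph_Theory.Graph_Theory"
    "Jordan_Normal_Form.Char_Poly"
begin

text \<open>
  A finite simple graph is represented as in \<open>Graph_Theory\<close>: a symmetric, loop-free relation
  on a finite vertex set (locale \<^locale>\<open>pair_graph\<close>).  An edge \<open>uv\<close> is the pair of arcs
  \<open>(u, v)\<close> and \<open>(v, u)\<close>, so the degree of a vertex is its out-degree.
\<close>

definition complete_graph :: "nat \<Rightarrow> nat pair_pre_digraph" where
  "complete_graph m =
     \<lparr> pverts = {..<m}, parcs = {(u, v). u < m \<and> v < m \<and> u \<noteq> v} \<rparr>"

definition graph_copies :: "nat \<Rightarrow> 'a pair_pre_digraph \<Rightarrow> (nat \<times> 'a) pair_pre_digraph" where
  "graph_copies m H =
     \<lparr> pverts = {..<m} \<times> pverts H,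
       parcs = {((i, u), (j, v)). i < m \<and> i = j \<and> (u, v) \<in> parcs H} \<rparr>"

definition graph_join ::
  "'a pair_pre_digraph \<Rightarrow> 'b pair_pre_digraph \<Rightarrow> ('a + 'b) pair_pre_digraph"
  (infixl "\<nabla>" 65) where
  "G \<nabla> H =
     \<lparr> pverts = pverts G <+> pverts H,
       parcs = map_prod Inl Inl ` parcs G \<union> map_prod Inr Inr ` parcs H
         \<union> (Inl ` pverts G) \<times> (Inr ` pverts H) \<union> (Inr ` pverts H) \<times> (Inl ` pverts G) \<rparr>"

lemma complete_graph_complete_digraph: "complete_digraph m (with_proj (complete_graph m))"
  unfolding complete_digraph_pair_def by (auto simp: complete_graph_def)

lemma pair_graph_complete_graph: "pair_graph (complete_graph m)"
  by (rule pair_graphI_complete[OF complete_graph_complete_digraph])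

lemma pair_graphI_subset:
  assumes "finite (pverts G)" "parcs G \<subseteq> pverts G \<times> pverts G" "sym (parcs G)"
    and "\<And>u. (u, u) \<notin> parcs G"
  shows "pair_graph G"
proof -
  have "finite (parcs G)"
    using assms(1,2) by (meson finite_SigmaI finite_subset)
  thus ?thesis
    using assms by unfold_locales (force simp: symmetric_def)+
qed

lemma pair_graph_props:
  assumes "pair_graph G"
  shows "finite (pverts G)" "parcs G \<subseteq> pverts G \<times> pverts G" "sym (parcs G)" "(u, u) \<notin> parcs G"
proof -
  interpret pair_graph G by fact
  show "finite (pverts G)" by (rule pair_finite_verts)
  show "parcs G \<subseteq> pverts G \<times> pverts G" by (auto dest: wellformed')
  show "sym (parcs G)" using pair_sym_arcs by (simp add: symmetric_def)
  show "(u, u) \<notin> parcs G" using pair_no_loops[of "(u, u)"] by auto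
qed

lemma pair_graph_graph_copies:
  assumes "pair_graph H"
  shows "pair_graph (graph_copies m H)"
proof (rule pair_graphI_subset)
  show "parcs (graph_copies m H) \<subseteq> pverts (graph_copies m H) \<times> pverts (graph_copies m H)"
    using pair_graph_props(2)[OF assms] by (auto simp: graph_copies_def)
  show "sym (parcs (graph_copies m H))"
    using pair_graph_props(3)[OF assms] by (auto simp: graph_copies_def sym_def)
qed (use pair_graph_props(1,4)[OF assms] in \<open>auto simp: graph_copies_def\<close>)

lemma pair_graph_graph_join:
  assumes "pair_graph G" "pair_graph H"
  shows "pair_graph (G \<nabla> H)"
proof (rule pair_graphI_subset)
  show "parcs (G \<nabla> H) \<subseteq> pverts (G \<nabla> H) \<times> pverts (G \<nabla> H)"
    using pair_graph_props(2)[OF assms(1)] pair_graph_props(2)[OF assms(2)]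
    by (auto simp: graph_join_def)
  show "sym (parcs (G \<nabla> H))"
    using pair_graph_props(3)[OF assms(1)] pair_graph_props(3)[OF assms(2)]
    unfolding sym_def graph_join_def by fastforce
qed (use pair_graph_props(1,4)[OF assms(1)] pair_graph_props(1,4)[OF assms(2)]
      in \<open>auto simp: graph_join_def\<close>)

text \<open>
  The matrices of a graph are taken with respect to an enumeration \<open>vs\<close> of its vertices.
\<close>

definition adjacency_matrix :: "'a pair_pre_digraph \<Rightarrow> 'a list \<Rightarrow> real mat" where
  "adjacency_matrix G vs =
     mat (length vs) (length vs) (\<lambda>(i, j). if (vs ! i, vs ! j) \<in> parcs G then 1 else 0)"

definition degree_matrix :: "'a pair_pre_digraph \<Rightarrow> 'a list \<Rightarrow> real mat" where
  "degree_matrix G vs = mat_diag (length vs) (\<lambda>i. real (out_degree (with_proj G) (vs ! i)))"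

text \<open>The matrix \<open>D\<^sup>-\<^sup>1\<^sup>/\<^sup>2\<close>, meaningful for graphs without isolated vertices.\<close>

definition degree_matrix_inv_sqrt :: "'a pair_pre_digraph \<Rightarrow> 'a list \<Rightarrow> real mat" where
  "degree_matrix_inv_sqrt G vs =
     mat_diag (length vs) (\<lambda>i. 1 / sqrt (real (out_degree (with_proj G) (vs ! i))))"

definition normalized_laplacian :: "'a pair_pre_digraph \<Rightarrow> 'a list \<Rightarrow> real mat" where
  "normalized_laplacian G vs =
     degree_matrix_inv_sqrt G vs * (degree_matrix G vs - adjacency_matrix G vs)
       * degree_matrix_inv_sqrt G vs"

text \<open>
  The multiset of eigenvalues, with algebraic multiplicity.  It does not depend on the enumeration
  chosen (lemma \<open>normalized_laplacian_spectrum_eq\<close>), and working over the reals loses no eigenvalue,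
  as the matrix is symmetric (lemma \<open>size_normalized_laplacian_spectrum\<close>).
\<close>

definition normalized_laplacian_spectrum :: "'a pair_pre_digraph \<Rightarrow> real multiset" where
  "normalized_laplacian_spectrum G =
     proots (char_poly (normalized_laplacian G (SOME vs. distinct vs \<and> set vs = pverts G)))"

definition normalized_laplacian_energy :: "'a pair_pre_digraph \<Rightarrow> real" where
  "normalized_laplacian_energy G = (\<Sum>x\<in>#normalized_laplacian_spectrum G. \<bar>x - 1\<bar>)"

definition L_noncospectral :: "'a pair_pre_digraph \<Rightarrow> 'b pair_pre_digraph \<Rightarrow> bool" where
  "L_noncospectral G H \<longleftrightarrow> normalized_laplacian_spectrum G \<noteq> normalized_laplacian_spectrum H"

lemma char_poly_reindex:
  fixes f :: "'a \<Rightarrow> 'a \<Rightarrow> 'b :: field"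
  assumes vs: "distinct vs" "set vs = V" and ws: "distinct ws" "set ws = V"
  shows "char_poly (mat (length vs) (length vs) (\<lambda>(i, j). f (vs ! i) (vs ! j))) =
         char_poly (mat (length ws) (length ws) (\<lambda>(i, j). f (ws ! i) (ws ! j)))"
    (is "char_poly ?A = char_poly ?B")
proof -
  define n where "n = length vs"
  have len: "length vs = n" "length ws = n"
    using vs ws by (auto simp: n_def distinct_card[symmetric])
  have bij: "bij_betw ((!) us) {0..<n} V" if "distinct us" "set us = V" "length us = n" for us
    by (rule bij_betw_nth) (use that in \<open>simp_all add: atLeast0LessThan\<close>)
  define P Q :: "'b mat"
    where "P = mat n n (\<lambda>(i, j). if vs ! i = ws ! j then 1 else 0)"
      and "Q = mat n n (\<lambda>(i, j). if ws ! i = vs ! j then 1 else 0)"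
  have left: "(\<Sum>k = 0..<n. (if x = us ! k then 1 else 0) * g (us ! k)) = (g x :: 'b)"
    if "distinct us" "set us = V" "length us = n" "x \<in> V" for x us g
  proof -
    have "(\<Sum>k = 0..<n. (if x = us ! k then 1 else 0) * g (us ! k)) =
          (\<Sum>v\<in>V. (if x = v then 1 else 0) * g v)"
      by (rule sum.reindex_bij_betw[OF bij[OF that(1-3)]])
    also have "\<dots> = (\<Sum>v\<in>V. if x = v then g v else 0)"
      by (rule sum.cong) auto
    also have "\<dots> = g x"
      using that by (auto simp: sum.delta')
    finally show ?thesis .
  qed
  have mem: "vs ! i \<in> V" "ws ! i \<in> V" if "i < n" for i
    using nth_mem[of i vs] nth_mem[of i ws] that unfolding len vs(2) ws(2) by simp_all
  have mm: "mat n n (\<lambda>(i, j). F i j) * mat n n (\<lambda>(i, j). H i j) =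
      mat n n (\<lambda>(i, j). \<Sum>k = 0..<n. F i k * H k j)" for F H :: "nat \<Rightarrow> nat \<Rightarrow> 'b"
    by (rule eq_matI) (simp_all add: scalar_prod_def)
  have one: "mat n n (\<lambda>(i, j). if us ! i = us ! j then 1 else 0) = (1\<^sub>m n :: 'b mat)"
    if "distinct us" "length us = n" for us :: "'a list"
    using that by (intro eq_matI) (simp_all add: nth_eq_iff_index_eq)
  have PQ: "P * Q = 1\<^sub>m n"
    unfolding P_def Q_def mm one[OF vs(1) len(1), symmetric]
    by (rule cong_mat[OF refl refl])
       (simp only: prod.case left[OF ws len(2) mem(1), where g = "\<lambda>w. if w = vs ! j then 1 else 0" for j])
  have QP: "Q * P = 1\<^sub>m n"
    unfolding P_def Q_def mm one[OF ws(1) len(2), symmetric]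
    by (rule cong_mat[OF refl refl])
       (simp only: prod.case left[OF vs len(1) mem(2), where g = "\<lambda>w. if w = ws ! j then 1 else 0" for j])
  have PB: "P * ?B = mat n n (\<lambda>(i, j). f (vs ! i) (ws ! j))"
    unfolding P_def len mm
    by (rule cong_mat[OF refl refl])
       (simp only: prod.case left[OF ws len(2) mem(1), where g = "\<lambda>w. f w (ws ! j)" for j])
  have "P * ?B * Q = ?A"
    unfolding PB
    unfolding Q_def len mm
  proof (rule cong_mat[OF refl refl], unfold prod.case)
    fix i j assume ij: "i < n" "j < n"
    have "(\<Sum>k = 0..<n. f (vs ! i) (ws ! k) * (if ws ! k = vs ! j then 1 else 0)) =
          (\<Sum>k = 0..<n. (if vs ! j = ws ! k then 1 else 0) * f (vs ! i) (ws ! k))"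
      by (rule sum.cong) auto
    also have "\<dots> = f (vs ! i) (vs ! j)"
      by (rule left[OF ws len(2) mem(1)[OF ij(2)]])
    finally show "(\<Sum>k = 0..<n. f (vs ! i) (ws ! k) * (if ws ! k = vs ! j then 1 else 0)) =
        f (vs ! i) (vs ! j)" .
  qed
  hence "similar_mat ?A ?B"
    unfolding similar_mat_def similar_mat_wit_def
    using PQ QP by (intro exI[of _ P] exI[of _ Q]) (auto simp: Let_def P_def Q_def len)
  thus ?thesis by (rule char_poly_similar)
qed

definition normalized_laplacian_entry :: "'a pair_pre_digraph \<Rightarrow> 'a \<Rightarrow> 'a \<Rightarrow> real" where
  "normalized_laplacian_entry G u v =
     ((if u = v then real (out_degree (with_proj G) u) else 0) - (if (u, v) \<in> parcs G then 1 else 0))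
       / (sqrt (real (out_degree (with_proj G) u)) * sqrt (real (out_degree (with_proj G) v)))"

lemma normalized_laplacian_altdef:
  assumes "distinct vs"
  shows "normalized_laplacian G vs =
    mat (length vs) (length vs) (\<lambda>(i, j). normalized_laplacian_entry G (vs ! i) (vs ! j))"
proof -
  let ?n = "length vs" and ?d = "\<lambda>i. 1 / sqrt (real (out_degree (with_proj G) (vs ! i)))"
  define M where "M = degree_matrix G vs - adjacency_matrix G vs"
  have M: "M \<in> carrier_mat ?n ?n"
    unfolding M_def degree_matrix_def adjacency_matrix_def mat_diag_def
    by (rule minus_carrier_mat) simp
  have entry: "M $$ (i, j) = (if i = j then real (out_degree (with_proj G) (vs ! i)) else 0)
      - (if (vs ! i, vs ! j) \<in> parcs G then 1 else 0)" if "i < ?n" "j < ?n" for i j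
    using that by (simp add: M_def degree_matrix_def adjacency_matrix_def mat_diag_def)
  have "normalized_laplacian G vs = mat_diag ?n ?d * M * mat_diag ?n ?d"
    unfolding normalized_laplacian_def degree_matrix_inv_sqrt_def M_def ..
  also have "\<dots> = mat ?n ?n (\<lambda>(i, j). ?d i * M $$ (i, j)) * mat_diag ?n ?d"
    by (simp only: mat_diag_mult_left[OF M])
  also have "\<dots> = mat ?n ?n
      (\<lambda>(i, j). mat ?n ?n (\<lambda>(i, j). ?d i * M $$ (i, j)) $$ (i, j) * ?d j)"
    by (rule mat_diag_mult_right) simp
  also have "\<dots> = mat ?n ?n (\<lambda>(i, j). normalized_laplacian_entry G (vs ! i) (vs ! j))"
    using assms
    by (intro cong_mat[OF refl refl]) (simp add: entry normalized_laplacian_entry_def nth_eq_iff_index_eq)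
  finally show ?thesis .
qed

lemma normalized_laplacian_spectrum_eq:
  assumes "distinct vs" "set vs = pverts G"
  shows "normalized_laplacian_spectrum G = proots (char_poly (normalized_laplacian G vs))"
proof -
  define ws where "ws = (SOME vs. distinct vs \<and> set vs = pverts G)"
  have ws: "distinct ws \<and> set ws = pverts G"
    unfolding ws_def by (rule someI[of _ vs]) (use assms in simp)
  show ?thesis
    unfolding normalized_laplacian_spectrum_def ws_def[symmetric]
      normalized_laplacian_altdef[OF assms(1)] normalized_laplacian_altdef[OF conjunct1[OF ws]]
    by (rule arg_cong[of _ _ proots], rule char_poly_reindex) (use assms ws in auto)
qed

lemma symmetric_real_mat_complex_eigenvalue:
  fixes A :: "real mat"
  assumes A: "A \<in> carrier_mat n n" and sym: "\<And>i j. i < n \<Longrightarrow> j < n \<Longrightarrow> A $$ (i, j) = A $$ (j, i)"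
    and ev: "eigenvalue (map_mat complex_of_real A) z"
  shows "z \<in> \<real>"
proof -
  from ev A obtain v where v: "v \<in> carrier_vec n" "v \<noteq> 0\<^sub>v n"
    and eq: "map_mat complex_of_real A *\<^sub>v v = z \<cdot>\<^sub>v v"
    by (auto simp: eigenvalue_def eigenvector_def)
  have row: "(\<Sum>j<n. of_real (A $$ (i, j)) * v $ j) = z * v $ i" if "i < n" for i
  proof -
    have "(map_mat complex_of_real A *\<^sub>v v) $ i = (z \<cdot>\<^sub>v v) $ i" by (simp add: eq)
    thus ?thesis
      using that A v by (simp add: scalar_prod_def atLeast0LessThan)
  qed
  define S where "S = (\<Sum>i<n. \<Sum>j<n. cnj (v $ i) * of_real (A $$ (i, j)) * v $ j)"
  have S: "S = z * of_real (\<Sum>i<n. (cmod (v $ i))\<^sup>2)"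
  proof -
    have "S = (\<Sum>i<n. cnj (v $ i) * (\<Sum>j<n. of_real (A $$ (i, j)) * v $ j))"
      by (simp add: S_def sum_distrib_left mult.assoc)
    also have "\<dots> = (\<Sum>i<n. z * of_real ((cmod (v $ i))\<^sup>2))"
      by (intro sum.cong refl) (simp only: lessThan_iff row, simp only: complex_norm_square mult_ac)
      finally show ?thesis by (simp add: sum_distrib_left)
  qed
  have "cnj S = (\<Sum>i<n. \<Sum>j<n. cnj (v $ j) * of_real (A $$ (j, i)) * v $ i)"
    unfolding S_def cnj_sum by (intro sum.cong refl) (auto simp: sym)
  also have "\<dots> = S"
    unfolding S_def by (rule sum.swap)
  finally have "S \<in> \<real>"
    by (simp add: complex_is_Real_iff complex_eq_iff)
  moreover have "(\<Sum>i<n. (cmod (v $ i))\<^sup>2) \<noteq> 0"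
  proof
    assume "(\<Sum>i<n. (cmod (v $ i))\<^sup>2) = 0"
    hence "\<forall>i<n. v $ i = 0" by (subst (asm) sum_nonneg_eq_0_iff) auto
    with v show False by (auto intro!: eq_vecI)
  qed
  ultimately show "z \<in> \<real>"
    unfolding S by (metis Reals_divide Reals_of_real nonzero_mult_div_cancel_right of_real_eq_0_iff)
qed

lemma map_poly_of_real_mult:
  "map_poly complex_of_real (p * q) = map_poly complex_of_real p * map_poly complex_of_real q"
proof -
  interpret map_poly_comm_ring_hom complex_of_real ..
  show ?thesis by (rule hom_mult)
qed

lemma size_proots_real:
  fixes p :: "real poly"
  assumes "p \<noteq> 0" "\<And>z. poly (map_poly complex_of_real p) z = 0 \<Longrightarrow> z \<in> \<real>"
  shows "size (proots p) = degree p"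
  using assms
proof (induction "degree p" arbitrary: p)
  case 0
  then obtain c where "p = [:c:]" by (metis degree_eq_zeroE)
  thus ?case by simp
next
  case (Suc d)
  have "degree (map_poly complex_of_real p) \<noteq> 0"
    using Suc(2) by simp
  then obtain z where z: "poly (map_poly complex_of_real p) z = 0"
    using fundamental_theorem_of_algebra constant_degree by metis
  with Suc.prems obtain r where "z = of_real r" by (auto elim: Reals_cases)
  with z have "poly p r = 0"
    by simp
  then obtain q where q: "p = [:-r, 1:] * q" by (auto simp: poly_eq_0_iff_dvd elim: dvdE)
  with Suc.prems have "q \<noteq> 0" by auto
  hence deg: "degree p = Suc (degree q)"
    unfolding q by (subst degree_mult_eq) auto
  have "size (proots q) = degree q"
  proof (rule Suc.hyps(1))
    fix w assume "poly (map_poly complex_of_real q) w = 0"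
    hence "poly (map_poly complex_of_real p) w = 0"
      unfolding q map_poly_of_real_mult by simp
    thus "w \<in> \<real>" by (rule Suc.prems)
  qed (use deg Suc(2) \<open>q \<noteq> 0\<close> in auto)
  moreover have "proots p = proots [:-r, 1:] + proots q"
    unfolding q by (rule proots_mult) (use \<open>q \<noteq> 0\<close> in auto)
  moreover have "proots [:-r, 1:] = {#r#}"
    using proots_linear_factor[of "-r"] by simp
  ultimately show ?case using deg by simp
qed

lemma size_normalized_laplacian_spectrum:
  assumes "pair_graph G"
  shows "size (normalized_laplacian_spectrum G) = card (pverts G)"
proof -
  interpret pair_graph G by fact
  obtain vs where vs: "distinct vs" "set vs = pverts G"
    using finite_distinct_list[OF pair_finite_verts] by blast
  define n where "n = length vs"
  define A where "A = normalized_laplacian G vs"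
  have A: "A \<in> carrier_mat n n"
    by (simp add: A_def n_def normalized_laplacian_altdef[OF vs(1)])
  have "(u, v) \<in> parcs G \<longleftrightarrow> (v, u) \<in> parcs G" for u v
    using pair_sym_arcs by (auto simp: symmetric_def dest: symD)
  hence "A $$ (i, j) = A $$ (j, i)" if "i < n" "j < n" for i j
    using that by (auto simp: A_def n_def normalized_laplacian_altdef[OF vs(1)] normalized_laplacian_entry_def mult.commute)
  note ev = symmetric_real_mat_complex_eigenvalue[OF A this]
  have "size (proots (char_poly A)) = degree (char_poly A)"
  proof (rule size_proots_real)
    show "char_poly A \<noteq> 0"
      using degree_monic_char_poly[OF A] by auto
    fix z assume "poly (map_poly complex_of_real (char_poly A)) z = 0"
    hence "eigenvalue (map_mat complex_of_real A) z"
      using A by (simp add: of_real_hom.char_poly_hom eigenvalue_root_char_poly[of _ n])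
    thus "z \<in> \<real>" by (intro ev)
  qed
  also have "\<dots> = card (pverts G)"
    using degree_monic_char_poly[OF A] vs by (simp add: n_def distinct_card[symmetric])
  finally show ?thesis
    using normalized_laplacian_spectrum_eq[OF vs] by (simp add: A_def)
qed

end

theory Submission
  imports Defs
begin

text \<open>
  Both graphs have the form \<open>aK\<^sub>2 \<nabla> H\<close>, where \<open>H\<close> is \<open>K\<^sub>b\<close> or \<open>bK\<^sub>1\<close>, so that the vertices of
  \<open>aK\<^sub>2\<close> have degree \<open>b + 1\<close> and those of \<open>H\<close> have a common degree \<open>d\<close>: it is \<open>2a + b - 1\<close> for \<open>K\<^sub>b\<close>
  and \<open>2a\<close> for \<open>bK\<^sub>1\<close>.  The normalized Laplacian is \<open>I - D\<^sup>1\<^sup>/\<^sup>2 M D\<^sup>-\<^sup>1\<^sup>/\<^sup>2\<close> with the averaging operator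
  \<open>M = D\<^sup>-\<^sup>1 A\<close>, so it suffices to find a basis of eigenfunctions of \<open>M\<close>; this avoids square roots.
  The symmetry of the graph suggests one.

  Functions that are \<open>\<pm>1\<close> on the two ends of one \<open>K\<^sub>2\<close> and vanish elsewhere give \<open>-1/(b+1)\<close>, \<open>a\<close>
  times.  Functions that are constant on each \<open>K\<^sub>2\<close>, have sum zero and vanish on \<open>H\<close> give \<open>1/(b+1)\<close>,
  \<open>a - 1\<close> times.  Functions on \<open>H\<close> with sum zero give \<open>-1/d\<close> for \<open>K\<^sub>b\<close> and \<open>0\<close> for \<open>bK\<^sub>1\<close>, \<open>b - 1\<close>
  times.  What remains are the functions that are constant on either side of the join: the constant
  function, with eigenvalue \<open>1\<close>, and the one that is \<open>D\<close>-orthogonal to it, whose eigenvalue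
  \<open>1/(b+1) - 2a/d\<close> is negative.  This is lemma
  \<open>normalized_laplacian_spectrum_copies_K2_join\<close>, and the linear algebra behind it is lemma
  \<open>normalized_laplacian_spectrum_eigenfunctions\<close>.

  The energy is the sum of the absolute values of these numbers.  The \<open>2a - 1\<close> functions on \<open>aK\<^sub>2\<close>
  contribute \<open>(2a - 1)/(b + 1)\<close>, the constant function \<open>1\<close>, and its companion
  \<open>2a/d - 1/(b + 1)\<close>.  For \<open>K\<^sub>b\<close> the functions on \<open>H\<close> add \<open>(b - 1)/d\<close>, which is exactly what
  \<open>2a/d\<close> lacks to \<open>1\<close>; for \<open>bK\<^sub>1\<close> they add nothing, but there \<open>2a/d\<close> is already \<open>1\<close>.  So both energies
  are \<open>2 + (2a - 2)/(b + 1)\<close>.  The spectra differ because \<open>M\<close> has the eigenvalue \<open>0\<close> only for \<open>bK\<^sub>1\<close>.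
\<close>

section \<open>Normalized Laplacian spectra from eigenfunctions\<close>

lemma proots_char_poly_diagonalizable:
  fixes A P :: "'a :: field mat"
  assumes A: "A \<in> carrier_mat n n" and P: "P \<in> carrier_mat n n" and "det P \<noteq> 0"
    and AP: "A * P = P * mat_diag n l"
  shows "proots (char_poly A) = mset (map l [0..<n])"
proof -
  obtain Q where Q: "Q \<in> carrier_mat n n" "P * Q = 1\<^sub>m n" "Q * P = 1\<^sub>m n"
    using det_non_zero_imp_unit[OF P \<open>det P \<noteq> 0\<close>, of "()"]
    by (auto simp: Units_def ring_mat_simps)
  have "A = A * (P * Q)"
    using A Q by simp
  also have "\<dots> = P * mat_diag n l * Q"
    using A P Q(1) by (simp add: AP flip: assoc_mult_mat)
  finally have "similar_mat A (mat_diag n l)"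
    unfolding similar_mat_def using A P Q by (blast intro: similar_mat_witI mat_diag_dim)
  hence "char_poly A = char_poly (mat_diag n l)"
    by (rule char_poly_similar)
  also have "\<dots> = (\<Prod>c\<leftarrow>diag_mat (mat_diag n l). [:- c, 1:])"
    by (rule char_poly_upper_triangular) (auto simp: mat_diag_def)
  also have "diag_mat (mat_diag n l) = map l [0..<n]"
    by (auto simp: diag_mat_def mat_diag_def)
  finally have "char_poly A = (\<Prod>c\<leftarrow>map l [0..<n]. [:- c, 1:])" .
  moreover have "proots (\<Prod>c\<leftarrow>cs. [:- c, 1:]) = mset cs" for cs :: "'a list"
  proof (induction cs)
    case (Cons c cs)
    have "(\<Prod>c\<leftarrow>cs. [:- c, 1:]) \<noteq> 0"
      by (auto simp: prod_list_zero_iff)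
    thus ?case
      using Cons by (simp only: list.map prod_list.Cons proots_mult[of "[:- c, 1:]"] pCons_eq_0_iff
          one_neq_zero simp_thms not_False_eq_True proots_linear_factor) simp
  qed simp
  ultimately show ?thesis
    by (simp only:)
qed

text \<open>
  If \<open>g\<close> satisfies \<open>D\<^sup>-\<^sup>1 A g = (1 - \<lambda>) g\<close>, then \<open>D\<^sup>1\<^sup>/\<^sup>2 g\<close> is an eigenvector of the normalized Laplacian
  for \<open>\<lambda>\<close>.  That the listed functions form a basis is asked for dually: only zero is orthogonal to all
  of them.  In concrete cases this means reading off relations between the values of \<open>y\<close>, which is
  easier than exhibiting a dual basis.  The eigenvalues are listed along with the functions so that the
  multiplicities can be read off the list.
\<close>

lemma normalized_laplacian_spectrum_eigenfunctions:
  fixes G :: "'v pair_pre_digraph" and gs :: "(real \<times> ('v \<Rightarrow> real)) list"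
  assumes fin: "finite (pverts G)" and arcs: "parcs G \<subseteq> pverts G \<times> pverts G"
    and deg: "\<And>v. v \<in> pverts G \<Longrightarrow> out_degree (with_proj G) v > 0"
    and len: "length gs = card (pverts G)"
    and eigen: "\<And>l g v. (l, g) \<in> set gs \<Longrightarrow> v \<in> pverts G \<Longrightarrow>
      sum g (parcs G `` {v}) = (1 - l) * real (out_degree (with_proj G) v) * g v"
    and complete: "\<And>y v. (\<And>l g. (l, g) \<in> set gs \<Longrightarrow> (\<Sum>v\<in>pverts G. y v * g v) = 0) \<Longrightarrow>
      v \<in> pverts G \<Longrightarrow> y v = 0"
  shows "normalized_laplacian_spectrum G = mset (map fst gs)"
proof -
  obtain vs where vs: "distinct vs" "set vs = pverts G"
    using finite_distinct_list[OF fin] by blast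
  define n where "n = length vs"
  have n: "length gs = n" "length vs = n"
    using len vs by (auto simp: n_def distinct_card[symmetric])
  have bij: "bij_betw ((!) vs) {0..<n} (pverts G)"
    by (rule bij_betw_nth) (use vs n in \<open>simp_all add: atLeast0LessThan\<close>)
  have vs_mem: "vs ! i \<in> pverts G" if "i < n" for i
    using that nth_mem[of i vs] n vs by simp
  define d where "d v = real (out_degree (with_proj G) v)" for v
  have d: "d v > 0" if "v \<in> pverts G" for v
    using deg[OF that] by (simp add: d_def)
  define A where "A = normalized_laplacian G vs"
  \<comment> \<open>The columns of \<open>P\<close> are the vectors \<open>D\<^sup>1\<^sup>/\<^sup>2 g\<close>.\<close>
  define P where "P = mat n n (\<lambda>(i, j). sqrt (d (vs ! i)) * snd (gs ! j) (vs ! i))"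
  have A: "A = mat n n (\<lambda>(i, j). normalized_laplacian_entry G (vs ! i) (vs ! j))"
    by (simp add: A_def n normalized_laplacian_altdef[OF vs(1)])
  have P: "P \<in> carrier_mat n n"
    by (simp add: P_def)
  have "A * P = P * mat_diag n (\<lambda>j. fst (gs ! j))"
  proof (rule eq_matI)
    fix i j assume "i < dim_row (P * mat_diag n (\<lambda>j. fst (gs ! j)))"
      "j < dim_col (P * mat_diag n (\<lambda>j. fst (gs ! j)))"
    hence ij: "i < n" "j < n"
      by (simp_all add: P_def mat_diag_def)
    obtain l g where lg: "gs ! j = (l, g)"
      by fastforce
    have mem: "(l, g) \<in> set gs"
      using ij n lg by (metis nth_mem)
    define v where "v = vs ! i"
    have v: "v \<in> pverts G"
      using ij vs_mem by (simp add: v_def)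
    have "(A * P) $$ (i, j) =
        (\<Sum>k = 0..<n. normalized_laplacian_entry G v (vs ! k) * (sqrt (d (vs ! k)) * g (vs ! k)))"
      using ij lg by (simp add: A P_def scalar_prod_def v_def)
    also have "\<dots> = (\<Sum>w\<in>pverts G. normalized_laplacian_entry G v w * (sqrt (d w) * g w))"
      by (rule sum.reindex_bij_betw[OF bij])
    also have "\<dots> = (\<Sum>w\<in>pverts G. (if w = v then d v * g v / sqrt (d v) else 0)
        - (if w \<in> parcs G `` {v} then g w / sqrt (d v) else 0))"
    proof (rule sum.cong[OF refl])
      fix w assume "w \<in> pverts G"
      thus "normalized_laplacian_entry G v w * (sqrt (d w) * g w) =
          (if w = v then d v * g v / sqrt (d v) else 0)
          - (if w \<in> parcs G `` {v} then g w / sqrt (d v) else 0)"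
        using d[of w] d[OF v]
        by (auto simp: normalized_laplacian_entry_def d_def[symmetric] field_simps)
    qed
    also have "\<dots> = d v * g v / sqrt (d v) - (\<Sum>w\<in>parcs G `` {v}. g w / sqrt (d v))"
    proof -
      have "pverts G \<inter> parcs G `` {v} = parcs G `` {v}"
        using arcs by auto
      hence "(\<Sum>w\<in>pverts G. if w \<in> parcs G `` {v} then g w / sqrt (d v) else 0) =
          (\<Sum>w\<in>parcs G `` {v}. g w / sqrt (d v))"
        by (simp only: sum.inter_restrict[OF fin, symmetric])
      thus ?thesis
        using fin v by (simp add: sum_subtractf del: Image_singleton_iff)
    qed
    also have "\<dots> = (d v * g v - sum g (parcs G `` {v})) / sqrt (d v)"
      by (simp add: sum_divide_distrib diff_divide_distrib)
    also have "\<dots> = l * d v * g v / sqrt (d v)"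
      unfolding eigen[OF mem v] by (simp add: d_def algebra_simps)
    also have "\<dots> = sqrt (d v) * g v * l"
      using d[OF v] by (simp add: field_simps)
    also have "\<dots> = (P * mat_diag n (\<lambda>j. fst (gs ! j))) $$ (i, j)"
      unfolding mat_diag_mult_right[OF P] using ij lg by (simp add: P_def v_def)
    finally show "(A * P) $$ (i, j) = (P * mat_diag n (\<lambda>j. fst (gs ! j))) $$ (i, j)" .
  qed (simp_all add: A P_def mat_diag_def)
  moreover have "det P \<noteq> 0"
  proof
    assume "det P = 0"
    hence "det (transpose_mat P) = 0"
      using det_transpose[OF P] by simp
    then obtain x where x: "x \<in> carrier_vec n" "x \<noteq> 0\<^sub>v n" "transpose_mat P *\<^sub>v x = 0\<^sub>v n"
      using det_0_iff_vec_prod_zero_field[of "transpose_mat P" n] P by auto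
    \<comment> \<open>A vector in the left kernel of \<open>P\<close>, rescaled by \<open>D\<^sup>1\<^sup>/\<^sup>2\<close>, is orthogonal to all listed functions.\<close>
    define y where "y v = sqrt (d v) * x $ (inv_into {0..<n} ((!) vs) v)" for v
    have y: "y (vs ! i) = sqrt (d (vs ! i)) * x $ i" if "i < n" for i
      unfolding y_def using that by (subst inv_into_f_f[OF bij_betw_imp_inj_on[OF bij]]) auto
    have "(\<Sum>v\<in>pverts G. y v * g v) = 0" if lg: "(l, g) \<in> set gs" for l g
    proof -
      obtain j where j: "j < n" "gs ! j = (l, g)"
        using lg n(1) by (auto simp: in_set_conv_nth)
      have "(\<Sum>v\<in>pverts G. y v * g v) = (\<Sum>i = 0..<n. y (vs ! i) * g (vs ! i))"
        by (rule sum.reindex_bij_betw[OF bij, symmetric])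
      also have "\<dots> = (transpose_mat P *\<^sub>v x) $ j"
        using j x(1) y by (auto simp: P_def scalar_prod_def mult_ac intro!: sum.cong)
      finally show ?thesis
        using x(3) j by simp
    qed
    hence "y (vs ! i) = 0" if "i < n" for i
      using complete[of y "vs ! i"] vs_mem[OF that] by blast
    hence "x $ i = 0" if "i < n" for i
      using y[OF that] d[OF vs_mem[OF that]] that by fastforce
    thus False
      using x(1,2) by (auto intro!: eq_vecI)
  qed
  ultimately have "proots (char_poly A) = mset (map (\<lambda>j. fst (gs ! j)) [0..<n])"
    using P by (intro proots_char_poly_diagonalizable) (simp_all add: A)
  also have "map (\<lambda>j. fst (gs ! j)) [0..<n] = map fst gs"
    using n by (auto intro: nth_equalityI)
  finally show ?thesis
    using normalized_laplacian_spectrum_eq[OF vs] by (simp add: A_def)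
qed

section \<open>Neighbourhoods in the join of copies of \<open>K\<^sub>2\<close> with a graph\<close>

text \<open>
  This makes a degree the neighbourhood sum of the constant function \<open>1\<close>, so that degrees follow from
  the same formulas as the action of the adjacency matrix.
\<close>

lemma out_degree_with_proj: "out_degree (with_proj G) v = card (parcs G `` {v})"
proof -
  have "parcs G `` {v} = snd ` out_arcs (with_proj G) v"
    by (force simp: out_arcs_def)
  moreover have "inj_on snd (out_arcs (with_proj G) v)"
    by (auto simp: inj_on_def out_arcs_def)
  ultimately show ?thesis
    by (simp add: out_degree_def card_image)
qed

lemma pverts_copies_K2_join:
  "pverts (graph_copies a (complete_graph 2) \<nabla> H) = ({..<a} \<times> {0, 1}) <+> pverts H"
  by (auto simp: graph_join_def graph_copies_def complete_graph_def less_2_cases_iff)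

lemma sum_times_doubleton:
  assumes "x \<noteq> y"
  shows "(\<Sum>p\<in>A \<times> {x, y}. f p) = (\<Sum>i\<in>A. f (i, x) + f (i, y))"
proof -
  have "(\<Sum>p\<in>A \<times> {x, y}. f p) = (\<Sum>i\<in>A. \<Sum>u\<in>{x, y}. f (i, u))"
    by (simp only: sum.cartesian_product split_def prod.collapse)
  with assms show ?thesis
    by simp
qed

lemma sum_copies_K2_join:
  assumes "finite (pverts H)"
  shows "sum f (pverts (graph_copies a (complete_graph 2) \<nabla> H)) =
    (\<Sum>i<a. f (Inl (i, 0)) + f (Inl (i, 1))) + (\<Sum>w\<in>pverts H. f (Inr w))"
  using assms by (simp add: pverts_copies_K2_join sum.Plus sum_times_doubleton)

lemma neighbours_copies_K2_join_Inl:
  assumes "i < a" "u < 2"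
  shows "parcs (graph_copies a (complete_graph 2) \<nabla> H) `` {Inl (i, u)} = {(i, 1 - u)} <+> pverts H"
  using assms
  by (force simp: graph_join_def graph_copies_def complete_graph_def less_2_cases_iff)

lemma neighbours_copies_K2_join_Inr:
  assumes "w \<in> pverts H"
  shows "parcs (graph_copies a (complete_graph 2) \<nabla> H) `` {Inr w} =
    ({..<a} \<times> {0, 1}) <+> parcs H `` {w}"
  using assms
  by (auto simp: graph_join_def graph_copies_def complete_graph_def less_2_cases_iff)

section \<open>The spectrum of the join\<close>

text \<open>
  The hypothesis on \<open>H\<close> says that its adjacency matrix is \<open>s (J - I)\<close> with \<open>J\<close> the all-ones matrix: the
  value \<open>s = 1\<close> gives \<open>K\<^sub>b\<close> and \<open>s = 0\<close> gives \<open>bK\<^sub>1\<close>.  The parameter lets one computation serve both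
  graphs.  The number \<open>d\<close> is the degree in the join of a vertex of \<open>H\<close>.
\<close>

lemma normalized_laplacian_spectrum_copies_K2_join:
  fixes H :: "'w pair_pre_digraph" and s :: real
  assumes H: "pair_graph H" and "a > 0" "b > 0" "s \<ge> 0" and b: "card (pverts H) = b"
    and nbr: "\<And>(g :: 'w \<Rightarrow> real) w. w \<in> pverts H \<Longrightarrow>
      sum g (parcs H `` {w}) = s * (sum g (pverts H) - g w)"
  defines "d \<equiv> 2 * real a + s * (real b - 1)"
  shows "normalized_laplacian_spectrum (graph_copies a (complete_graph 2) \<nabla> H) =
    {#0, 1 - (1 / (real b + 1) - 2 * real a / d)#}
    + replicate_mset a (1 + 1 / (real b + 1)) + replicate_mset (a - 1) (1 - 1 / (real b + 1))
    + replicate_mset (b - 1) (1 + s / d)"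
proof -
  define G where "G = graph_copies a (complete_graph 2) \<nabla> H"
  define c where "c = real b + 1"
  have G: "pair_graph G"
    unfolding G_def by (intro pair_graph_graph_join pair_graph_graph_copies pair_graph_complete_graph H)
  have finW: "finite (pverts H)"
    by (rule pair_graph_props[OF H])
  have "d > 0" "c > 0"
    using \<open>a > 0\<close> \<open>b > 0\<close> \<open>s \<ge> 0\<close> by (auto simp: d_def c_def intro!: add_pos_nonneg)
  obtain w0 where w0: "w0 \<in> pverts H"
    using b \<open>b > 0\<close> by (metis all_not_in_conv card.empty less_numeral_extra(3))
  obtain ws where ws: "distinct ws" "set ws = pverts H - {w0}"
    using finite_distinct_list[of "pverts H - {w0}"] finW by blast
  have len_ws: "length ws = b - 1"
    using ws w0 b finW by (metis card_Diff_singleton distinct_card)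

  have sumV: "sum f (pverts G) = (\<Sum>i<a. f (Inl (i, 0)) + f (Inl (i, 1))) + (\<Sum>w\<in>pverts H. f (Inr w))"
    for f :: "_ \<Rightarrow> real"
    unfolding G_def by (rule sum_copies_K2_join[OF finW])
  have VE: thesis if "v \<in> pverts G" "\<And>i u. v = Inl (i, u) \<Longrightarrow> i < a \<Longrightarrow> u = 0 \<or> u = 1 \<Longrightarrow> thesis"
      "\<And>w. v = Inr w \<Longrightarrow> w \<in> pverts H \<Longrightarrow> thesis" for v thesis
    using that by (auto simp: G_def pverts_copies_K2_join)
  have NL: "sum g (parcs G `` {Inl (i, u)}) = g (Inl (i, 1 - u)) + (\<Sum>w\<in>pverts H. g (Inr w))"
    if "i < a" "u = 0 \<or> u = 1" for g :: "_ \<Rightarrow> real" and i u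
    unfolding G_def using that finW
    by (subst neighbours_copies_K2_join_Inl) (auto simp: sum.Plus)
  have NR: "sum g (parcs G `` {Inr w}) = (\<Sum>i<a. g (Inl (i, 0)) + g (Inl (i, 1)))
      + s * ((\<Sum>w\<in>pverts H. g (Inr w)) - g (Inr w))"
    if w: "w \<in> pverts H" for g :: "_ \<Rightarrow> real" and w
  proof -
    have "finite (parcs H `` {w})"
      by (rule finite_subset[OF _ finW]) (use pair_graph_props(2)[OF H] in auto)
    thus ?thesis
      unfolding G_def neighbours_copies_K2_join_Inr[OF w]
      using nbr[OF w, of "\<lambda>w. g (Inr w)"] by (simp add: sum.Plus sum_times_doubleton)
  qed
  have deg: "real (out_degree (with_proj G) v) = sum (\<lambda>_. 1) (parcs G `` {v})" for v
    by (simp add: out_degree_with_proj)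
  have degL: "real (out_degree (with_proj G) (Inl (i, u))) = c" if "i < a" "u = 0 \<or> u = 1" for i u
    unfolding deg NL[OF that] by (simp add: b c_def)
  have degR: "real (out_degree (with_proj G) (Inr w)) = d" if "w \<in> pverts H" for w
    unfolding deg NR[OF that] by (simp add: b d_def)

  \<comment> \<open>The function \<open>balance\<close> is constant on either side of the join and has degree-weighted sum
    \<open>2a c (b d) - b d (2a c) = 0\<close>, which forces its two values up to a factor.  The functions \<open>pair i\<close>
    and \<open>point w\<close> compare a copy of \<open>K\<^sub>2\<close> with copy \<open>0\<close>, and a vertex of \<open>H\<close> with \<open>w0\<close>; for
    \<open>i = 0\<close> and \<open>w = w0\<close> they vanish, so these indices are left out.\<close>
  define balance :: "nat \<times> nat + 'w \<Rightarrow> real"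
    where "balance = case_sum (\<lambda>_. real b * d) (\<lambda>_. - 2 * real a * c)"
  define alt :: "nat \<Rightarrow> nat \<times> nat + 'w \<Rightarrow> real"
    where "alt i = case_sum (\<lambda>(j, u). if j = i then 1 - 2 * real u else 0) (\<lambda>_. 0)" for i
  define pair :: "nat \<Rightarrow> nat \<times> nat + 'w \<Rightarrow> real"
    where "pair i = case_sum (\<lambda>(j, u). of_bool (j = i) - of_bool (j = 0)) (\<lambda>_. 0)" for i
  define point :: "'w \<Rightarrow> nat \<times> nat + 'w \<Rightarrow> real"
    where "point w = case_sum (\<lambda>_. 0) (\<lambda>w'. of_bool (w' = w) - of_bool (w' = w0))" for w
  define gs where "gs = [(0, \<lambda>_. 1), (1 - (1 / c - 2 * real a / d), balance)]
    @ map (\<lambda>i. (1 + 1 / c, alt i)) [0..<a] @ map (\<lambda>i. (1 - 1 / c, pair i)) [1..<a]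
    @ map (\<lambda>w. (1 + s / d, point w)) ws"
  have gs_cases: thesis if "(l, g) \<in> set gs"
    "l = 0 \<Longrightarrow> g = (\<lambda>_. 1) \<Longrightarrow> thesis"
    "l = 1 - (1 / c - 2 * real a / d) \<Longrightarrow> g = balance \<Longrightarrow> thesis"
    "\<And>i. l = 1 + 1 / c \<Longrightarrow> g = alt i \<Longrightarrow> i < a \<Longrightarrow> thesis"
    "\<And>i. l = 1 - 1 / c \<Longrightarrow> g = pair i \<Longrightarrow> 0 < i \<Longrightarrow> i < a \<Longrightarrow> thesis"
    "\<And>w. l = 1 + s / d \<Longrightarrow> g = point w \<Longrightarrow> w \<in> pverts H \<Longrightarrow> w \<noteq> w0 \<Longrightarrow> thesis"
    for l g thesis
  proof -
    have "l = 0 \<and> g = (\<lambda>_. 1) \<or> l = 1 - (1 / c - 2 * real a / d) \<and> g = balance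
      \<or> (\<exists>i. l = 1 + 1 / c \<and> g = alt i \<and> i < a) \<or> (\<exists>i. l = 1 - 1 / c \<and> g = pair i \<and> 0 < i \<and> i < a)
      \<or> (\<exists>w. l = 1 + s / d \<and> g = point w \<and> w \<in> pverts H \<and> w \<noteq> w0)"
      using that(1) ws(2) unfolding gs_def by auto
    thus thesis
      using that(2-) by blast
  qed

  have eigenI: "sum g (parcs G `` {v}) = (1 - l) * real (out_degree (with_proj G) v) * g v"
    if v: "v \<in> pverts G"
      and L0: "\<And>i. i < a \<Longrightarrow> g (Inl (i, 1)) + (\<Sum>w\<in>pverts H. g (Inr w)) = (1 - l) * c * g (Inl (i, 0))"
      and L1: "\<And>i. i < a \<Longrightarrow> g (Inl (i, 0)) + (\<Sum>w\<in>pverts H. g (Inr w)) = (1 - l) * c * g (Inl (i, 1))"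
      and R: "\<And>w. w \<in> pverts H \<Longrightarrow> (\<Sum>i<a. g (Inl (i, 0)) + g (Inl (i, 1)))
        + s * ((\<Sum>w\<in>pverts H. g (Inr w)) - g (Inr w)) = (1 - l) * d * g (Inr w)" for v g l
    using v
  proof (rule VE)
    fix i u assume v: "v = Inl (i, u)" "i < a" "u = 0 \<or> u = 1"
    thus ?thesis
      using L0[OF v(2)] L1[OF v(2)] by (auto simp: NL degL simp del: Image_singleton_iff)
  next
    fix w assume "v = Inr w" "w \<in> pverts H"
    thus ?thesis
      using R[of w] by (simp add: NR degR)
  qed

  have "normalized_laplacian_spectrum G = mset (map fst gs)"
  proof (rule normalized_laplacian_spectrum_eigenfunctions)
    show "finite (pverts G)" "parcs G \<subseteq> pverts G \<times> pverts G"
      by (rule pair_graph_props[OF G])+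
    have "real (card (pverts G)) = 2 * real a + real b"
      using sumV[of "\<lambda>_. 1"] by (simp add: b)
    moreover have "real (length gs) = 2 * real a + real b"
      using \<open>a > 0\<close> \<open>b > 0\<close> by (simp add: gs_def len_ws of_nat_diff)
    ultimately show "length gs = card (pverts G)"
      by simp
  next
    fix v assume "v \<in> pverts G"
    thus "out_degree (with_proj G) v > 0"
    proof (rule VE)
      fix i u assume "v = Inl (i, u)" "i < a" "u = 0 \<or> u = 1"
      thus ?thesis
        using degL[of i u] \<open>c > 0\<close> by (metis of_nat_0_less_iff)
    next
      fix w assume "v = Inr w" "w \<in> pverts H"
      thus ?thesis
        using degR[of w] \<open>d > 0\<close> by (metis of_nat_0_less_iff)
    qed
  next
    fix l g v assume lg: "(l, g) \<in> set gs" and v: "v \<in> pverts G"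
    show "sum g (parcs G `` {v}) = (1 - l) * real (out_degree (with_proj G) v) * g v"
      using lg
    proof (rule gs_cases)
      assume "l = 0" "g = (\<lambda>_. 1)"
      thus ?thesis by (simp add: deg)
    next
      assume l: "l = 1 - (1 / c - 2 * real a / d)" and g: "g = balance"
      show ?thesis
      proof (rule eigenI[OF v])
        \<comment> \<open>On \<open>aK\<^sub>2\<close> the eigenvalue of \<open>D\<^sup>-\<^sup>1 A\<close> comes out as \<open>1/c - 2a/d\<close>; on \<open>H\<close> the same value is
          reached through \<open>s (b - 1) = d - 2a\<close> and \<open>c = b + 1\<close>.\<close>
        have "b * d - 2 * real a * c * b = (1 - l) * c * (b * d)"
          using \<open>c > 0\<close> \<open>d > 0\<close> by (simp add: l field_simps)
        thus "g (Inl (i, 1)) + (\<Sum>w\<in>pverts H. g (Inr w)) = (1 - l) * c * g (Inl (i, 0))"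
          "g (Inl (i, 0)) + (\<Sum>w\<in>pverts H. g (Inr w)) = (1 - l) * c * g (Inl (i, 1))" for i
          by (simp_all add: g balance_def b algebra_simps)
        have "real a * (b * d + b * d) + s * (b * (- 2 * real a * c) - (- 2 * real a * c))
            = 2 * real a * b * d - 2 * real a * c * (s * (real b - 1))"
          by (simp add: algebra_simps)
        also have "s * (real b - 1) = d - 2 * real a"
          by (simp add: d_def)
        also have "2 * real a * b * d - 2 * real a * c * (d - 2 * real a)
            = (d - 2 * real a * c) * (- 2 * real a)"
          by (simp add: c_def algebra_simps)
        also have "\<dots> = (1 - l) * d * (- 2 * real a * c)"
          using \<open>c > 0\<close> \<open>d > 0\<close> by (simp add: l field_simps)
        finally show "(\<Sum>i<a. g (Inl (i, 0)) + g (Inl (i, 1)))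
            + s * ((\<Sum>w\<in>pverts H. g (Inr w)) - g (Inr w)) = (1 - l) * d * g (Inr w)" for w
          by (simp only: g balance_def sum.case sum_constant card_lessThan b)
      qed
    next
      fix i assume "l = 1 + 1 / c" "g = alt i" "i < a"
      thus ?thesis
        using \<open>c > 0\<close> by (intro eigenI[OF v]) (simp_all add: alt_def sum.distrib)
    next
      fix i assume g: "l = 1 - 1 / c" "g = pair i" "0 < i" "i < a"
      have "(\<Sum>j<a. of_bool (j = i) - of_bool (j = 0)) = (0 :: real)"
        using g \<open>a > 0\<close> by (simp add: sum_subtractf of_bool_def)
      hence "(\<Sum>j<a. 2 * of_bool (j = i) - 2 * of_bool (j = 0)) = (0 :: real)"
        by (simp only: right_diff_distrib[symmetric] sum_distrib_left[symmetric] mult_zero_right)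
      thus ?thesis
        using \<open>c > 0\<close> g by (intro eigenI[OF v]) (simp_all add: pair_def sum.distrib)
    next
      fix w assume g: "l = 1 + s / d" "g = point w" "w \<in> pverts H" "w \<noteq> w0"
      have "(\<Sum>w'\<in>pverts H. of_bool (w' = w) - of_bool (w' = w0)) = (0 :: real)"
        using g finW w0 by (simp add: sum_subtractf of_bool_def)
      thus ?thesis
        using \<open>d > 0\<close> g by (intro eigenI[OF v]) (simp_all add: point_def)
    qed
  next
    fix y :: "nat \<times> nat + 'w \<Rightarrow> real" and v
    assume orth: "\<And>l g. (l, g) \<in> set gs \<Longrightarrow> (\<Sum>v\<in>pverts G. y v * g v) = 0"
      and v: "v \<in> pverts G"
    \<comment> \<open>Orthogonality to \<open>alt\<close>, \<open>pair\<close> and \<open>point\<close> makes \<open>y\<close> equal to a constant \<open>p\<close> on \<open>aK\<^sub>2\<close> and \<open>q\<close> on \<open>H\<close>;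
      orthogonality to \<open>balance\<close> gives \<open>p\<close> and \<open>q\<close> the same sign, and to \<open>1\<close> a weighted sum zero.\<close>
    define p q where "p = y (Inl (0, 0))" and "q = y (Inr w0)"
    have y_alt: "y (Inl (i, 1)) = y (Inl (i, 0))" if "i < a" for i
    proof -
      have "(\<Sum>v\<in>pverts G. y v * alt i v) =
          (\<Sum>j<a. y (Inl (j, 0)) * alt i (Inl (j, 0)) + y (Inl (j, 1)) * alt i (Inl (j, 1)))"
        unfolding sumV by (simp add: alt_def)
      also have "\<dots> = (\<Sum>j<a. if j = i then y (Inl (i, 0)) - y (Inl (i, 1)) else 0)"
        by (rule sum.cong[OF refl]) (simp add: alt_def)
      also have "\<dots> = y (Inl (i, 0)) - y (Inl (i, 1))"
        using that by simp
      finally have eq: "(\<Sum>v\<in>pverts G. y v * alt i v) = y (Inl (i, 0)) - y (Inl (i, 1))" .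
      have "(1 + 1 / c, alt i) \<in> set gs"
        using that by (auto simp: gs_def)
      from eq orth[OF this] show ?thesis
        by simp
    qed
    have y_pair: "y (Inl (i, 0)) = p" if "i < a" for i
    proof (cases "i = 0")
      case False
      have "(\<Sum>v\<in>pverts G. y v * pair i v) =
          (\<Sum>j<a. y (Inl (j, 0)) * pair i (Inl (j, 0)) + y (Inl (j, 1)) * pair i (Inl (j, 1)))"
        unfolding sumV by (simp add: pair_def)
      also have "\<dots> = (\<Sum>j<a. (if j = i then 2 * y (Inl (i, 0)) else 0) - (if j = 0 then 2 * p else 0))"
        by (rule sum.cong[OF refl]) (use False y_alt in \<open>auto simp: pair_def p_def\<close>)
      also have "\<dots> = 2 * y (Inl (i, 0)) - 2 * p"
        using that by (simp add: sum_subtractf)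
      finally have eq: "(\<Sum>v\<in>pverts G. y v * pair i v) = 2 * y (Inl (i, 0)) - 2 * p" .
      have "(1 - 1 / c, pair i) \<in> set gs"
        using that False by (auto simp: gs_def)
      from eq orth[OF this] show ?thesis
        by simp
    qed (simp add: p_def)
    have y_pair': "y (Inl (i, Suc 0)) = p" if "i < a" for i
      using y_alt[OF that] y_pair[OF that] by simp
    have y_point: "y (Inr w) = q" if "w \<in> pverts H" for w
    proof (cases "w = w0")
      case False
      have "(\<Sum>v\<in>pverts G. y v * point w v) = (\<Sum>w'\<in>pverts H. y (Inr w') * point w (Inr w'))"
        unfolding sumV by (simp add: point_def)
      also have "\<dots> =
          (\<Sum>w'\<in>pverts H. (if w' = w then y (Inr w) else 0) - (if w' = w0 then q else 0))"
        by (rule sum.cong[OF refl]) (use False in \<open>auto simp: point_def q_def\<close>)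
      also have "\<dots> = y (Inr w) - q"
        using that finW w0 by (simp add: sum_subtractf)
      finally have eq: "(\<Sum>v\<in>pverts G. y v * point w v) = y (Inr w) - q" .
      have "(1 + s / d, point w) \<in> set gs"
        using that False ws(2) by (auto simp: gs_def)
      from eq orth[OF this] show ?thesis
        by simp
    qed (simp add: q_def)
    have "2 * real a * p + real b * q = 0"
    proof -
      have "(\<Sum>v\<in>pverts G. y v * 1) = 2 * real a * p + real b * q"
        unfolding sumV by (simp add: y_pair y_pair' y_point b)
      thus ?thesis
        using orth[of 0 "\<lambda>_. 1"] by (simp add: gs_def)
    qed
    moreover have "(2 * real a * b) * (d * p - c * q) = 0"
    proof -
      have "(\<Sum>v\<in>pverts G. y v * balance v) = (2 * real a * b) * (d * p - c * q)"
        unfolding sumV by (simp add: balance_def y_pair y_pair' y_point b algebra_simps)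
      thus ?thesis
        using orth[of "1 - (1 / c - 2 * real a / d)" balance] by (simp add: gs_def)
    qed
    hence "q = d / c * p"
      using \<open>a > 0\<close> \<open>b > 0\<close> \<open>c > 0\<close> by (simp add: field_simps)
    ultimately have "p * (2 * real a + real b * (d / c)) = 0" "q = d / c * p"
      by (simp_all add: algebra_simps)
    moreover have "2 * real a + real b * (d / c) > 0"
      using \<open>a > 0\<close> \<open>c > 0\<close> \<open>d > 0\<close> by (intro add_pos_nonneg) auto
    ultimately have "p = 0" "q = 0"
      by auto
    with v show "y v = 0"
      by (elim VE) (auto simp: y_pair y_pair' y_point)
  qed
  also have "\<dots> = {#0, 1 - (1 / c - 2 * real a / d)#}
      + replicate_mset a (1 + 1 / c) + replicate_mset (a - 1) (1 - 1 / c)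
      + replicate_mset (b - 1) (1 + s / d)"
    by (simp add: gs_def o_def map_replicate_const len_ws)
  finally show ?thesis
    by (simp add: G_def c_def)
qed

section \<open>Equal energy of the two joins\<close>

theorem theorem6:
  fixes a b :: nat
    and G :: "(nat \<times> nat + nat) pair_pre_digraph"
    and G' :: "(nat \<times> nat + nat \<times> nat) pair_pre_digraph"
  assumes "a \<ge> 2" and "b \<ge> 2"
    and "G = graph_copies a (complete_graph 2) \<nabla> complete_graph b"
    and "G' = graph_copies a (complete_graph 2) \<nabla> graph_copies b (complete_graph 1)"
  shows "card (pverts G) = 2 * a + b \<and> card (pverts G') = 2 * a + b \<and>
    L_noncospectral G G' \<and>
    normalized_laplacian_energy G = normalized_laplacian_energy G' \<and>
    normalized_laplacian_energy G = (2 * real a + 2 * real b) / (real b + 1)"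
proof -
  have H: "pair_graph (complete_graph b)" "pair_graph (graph_copies b (complete_graph 1))"
    by (intro pair_graph_graph_copies pair_graph_complete_graph)+
  have card: "card (pverts (complete_graph b)) = b"
    "card (pverts (graph_copies b (complete_graph 1))) = b"
    by (simp_all add: complete_graph_def graph_copies_def)
  have card_G: "card (pverts G) = 2 * a + b" and card_G': "card (pverts G') = 2 * a + b"
    using card pair_graph_props(1)[OF H(1)] pair_graph_props(1)[OF H(2)]
    unfolding assms(3,4) pverts_copies_K2_join
    by (simp_all add: card_Plus card_cartesian_product)
  define d where "d = 2 * real a + (real b - 1)"
  have "d > 0"
    using assms(1) by (simp add: d_def)
  have "sum g (parcs (complete_graph b) `` {w}) = 1 * (sum g (pverts (complete_graph b)) - g w)"
    if "w \<in> pverts (complete_graph b)" for g :: "nat \<Rightarrow> real" and w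
  proof -
    have "parcs (complete_graph b) `` {w} = pverts (complete_graph b) - {w}"
      using that by (auto simp: complete_graph_def)
    thus ?thesis
      using that pair_graph_props(1)[OF H(1)] by (simp add: sum_diff1)
  qed
  from normalized_laplacian_spectrum_copies_K2_join[OF H(1) _ _ _ card(1) this] assms(1,2)
  have spec_G: "normalized_laplacian_spectrum G =
    {#0, 1 - (1 / (real b + 1) - 2 * real a / d)#}
    + replicate_mset a (1 + 1 / (real b + 1)) + replicate_mset (a - 1) (1 - 1 / (real b + 1))
    + replicate_mset (b - 1) (1 + 1 / d)"
    by (simp add: assms(3) d_def)
  have "sum g (parcs (graph_copies b (complete_graph 1)) `` {w}) =
      0 * (sum g (pverts (graph_copies b (complete_graph 1))) - g w)"
    for g :: "nat \<times> nat \<Rightarrow> real" and w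
  proof -
    have "parcs (graph_copies b (complete_graph 1)) = {}"
      by (auto simp: complete_graph_def graph_copies_def)
    thus ?thesis
      by simp
  qed
  from normalized_laplacian_spectrum_copies_K2_join[OF H(2) _ _ _ card(2) this] assms(1,2)
  have spec_G': "normalized_laplacian_spectrum G' =
    {#0, 1 - (1 / (real b + 1) - 1)#}
    + replicate_mset a (1 + 1 / (real b + 1)) + replicate_mset (a - 1) (1 - 1 / (real b + 1))
    + replicate_mset (b - 1) 1"
    by (simp add: assms(4))
  \<comment> \<open>This fixes the sign of the last eigenvalue of \<open>D\<^sup>-\<^sup>1 A\<close> for \<open>G\<close>, which the energy needs, and shows that
    it is not \<open>0\<close>, which separates the spectra.\<close>
  have small: "1 / (real b + 1) < 2 * real a / d"
  proof -
    have "real b < 2 * real a * real b"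
      using assms(1,2) by simp
    thus ?thesis
      using \<open>d > 0\<close> by (simp add: d_def field_simps)
  qed
  have energy_G: "normalized_laplacian_energy G = (2 * real a + 2 * real b) / (real b + 1)"
  proof -
    have "normalized_laplacian_energy G = 1 + (2 * real a / d - 1 / (real b + 1))
        + real a / (real b + 1) + (real a - 1) / (real b + 1) + (real b - 1) / d"
      using small \<open>d > 0\<close> assms(1,2)
      by (simp add: normalized_laplacian_energy_def spec_G abs_if of_nat_diff)
    also have "\<dots> = 1 + (2 * real a + (real b - 1)) / d + (2 * real a - 2) / (real b + 1)"
      by (simp add: add_divide_distrib diff_divide_distrib)
    also have "(2 * real a + (real b - 1)) / d = 1"
      using \<open>d > 0\<close> by (simp add: d_def)
    also have "1 + 1 + (2 * real a - 2) / (real b + 1) = (2 * real a + 2 * real b) / (real b + 1)"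
      by (simp add: field_simps)
    finally show ?thesis .
  qed
  have energy_G': "normalized_laplacian_energy G' = (2 * real a + 2 * real b) / (real b + 1)"
  proof -
    have "normalized_laplacian_energy G' = 1 + (1 - 1 / (real b + 1))
        + real a / (real b + 1) + (real a - 1) / (real b + 1)"
      using assms(1,2)
      by (simp add: normalized_laplacian_energy_def spec_G' abs_if of_nat_diff)
    also have "\<dots> = 2 + (2 * real a - 2) / (real b + 1)"
      by (simp add: add_divide_distrib diff_divide_distrib)
    also have "\<dots> = (2 * real a + 2 * real b) / (real b + 1)"
      by (simp add: field_simps)
    finally show ?thesis .
  qed
  \<comment> \<open>As \<open>b \<ge> 2\<close>, there is a nonzero function on \<open>bK\<^sub>1\<close> with sum zero; \<open>D\<^sup>-\<^sup>1 A\<close> annihilates it.\<close>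
  have "1 \<in># normalized_laplacian_spectrum G'"
    using assms(2) by (simp add: spec_G')
  moreover have "1 \<notin># normalized_laplacian_spectrum G"
    using small \<open>d > 0\<close> by (auto simp: spec_G)
  ultimately have "L_noncospectral G G'"
    by (auto simp: L_noncospectral_def)
  with card_G card_G' energy_G energy_G' show ?thesis
    by simp
qed

end
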